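(* $$H_M=\sum_{k\in\Lambda,\,\sigma=\uparrow,\downarrow}\sqrt{\xi_k^2+\Delta_k^2}\;\gamma_{k\sigma}^*\gamma_{k\sigma}+\sum_{k\in\Lambda}\left\{\xi_k-\sqrt{\xi_k^2+\Delta_k^2}+\Delta_k\left(\Psi_{BCS},C_{-k\downarrow}C_{k\uparrow}\Psi_{BCS}\right)\right\}.$$
   Context: Fix (large) real numbers $L,K_{max}>0$ and let $\Lambda=\{\frac{2\pi}{L}(n_1,n_2,n_3)\in\mathbb{R}^3: n_1,n_2,n_3\in\mathbb{Z},\ \frac{2\pi}{L}\sqrt{n_1^2+n_2^2+n_3^2}\le K_{max}\}$, a finite set with $M$ elements, whose elements are arranged in a fixed order. Let $\mathcal{H}=\mathbb{C}^{2^{2M}}$ with its standard inner product $(\cdot,\cdot)$; its standard unit vectors are labelled $|n_{k\uparrow},n_{k\downarrow},n_{k'\uparrow},n_{k'\downarrow},\ldots\rangle$ with $n_{k\sigma}\in\{0,1\}$, $k\in\Lambda$, $\sigma\in\{\uparrow,\downarrow\}$, and $|0\rangle$ denotes the one with all $n_{k\sigma}=0$. The annihilation operator $C_{k\sigma}$ is the linear operator on $\mathcal{H}$ which sends a standard unit vector with $n_{k\sigma}=1$ to $(-1)^{s}$ times the standard unit vector obtained by replacing $n_{k\sigma}$ by $0$, where $s$ is the sum of the occupation numbers to the left of $n_{k\sigma}$, and sends a standard unit vector with $n_{k\sigma}=0$ to $0$. The creation operator $C_{k\sigma}^*$ sends a standard unit vector with $n_{k\sigma}=0$ to $(-1)^{s}$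 times the one with $n_{k\sigma}$ replaced by $1$ (same $s$), and one with $n_{k\sigma}=1$ to $0$; it is the adjoint of $C_{k\sigma}$. Let $m,\mu,\hbar>0$ and $\xi_k=\hbar^2|k|^2/(2m)-\mu$. Let $U_{k,k'}$ ($k,k'\in\Lambda$) be real with $U_{k,k'}\le 0$, $U_{k',k}=U_{k,k'}$, $U_{-k,-k'}=U_{k,k'}$, $U_{k,k}=0$. It is assumed that there is a function $\Delta_k\ge0$ of $k\in\Lambda$ with $\Delta_{-k}=\Delta_k$ and $\xi_k^2+\Delta_k^2>0$ for all $k$, solving the gap equation $\Delta_k=-\frac12\sum_{k'\in\Lambda}U_{k,k'}\Delta_{k'}/\sqrt{\xi_{k'}^2+\Delta_{k'}^2}$; fix such a $\Delta$. Let $\theta_k\in[0,\pi/2]$ be defined by $\sin2\theta_k=\Delta_k/\sqrt{\xi_k^2+\Delta_k^2}$, $\cos2\theta_k=\xi_k/\sqrt{\xi_k^2+\Delta_k^2}$. Let $G_B=i\sum_{k\in\Lambda}\theta_k(C_{-k\downarrow}C_{k\uparrow}-C_{k\uparrow}^*C_{-k\downarrow}^* )$. The BCS state is $\Psi_{BCS}=e^{iG_B}|0\rangle$, and the Bogoliubov transforms are $\gamma_{k\sigma}=e^{iG_B}C_{k\sigma}e^{-iG_B}$, with adjoints $\gamma_{k\sigma}^*$. The mean field Hamiltonian is $$H_M=\sum_{k\in\Lambda,\,\sigma=\uparrow,\downarrow}\xi_kC_{k\sigma}^*C_{k\sigma}-\sum_{k\in\Lambda}\Delta_k\left(C_{-k\downarrow}C_{k\uparrow}+C_{k\uparrow}^*C_{-k\downarrow}^*\right)+\sum_{k\in\Lambda}\Delta_k\left(\Psi_{BCS},C_{-k\downarrow}C_{k\uparrow}\Psi_{BCS}\right).$$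 Scalars are identified with multiples of the identity operator. *)

theory Defs
  imports
    "HOL-Analysis.Analysis"
    "Jordan_Normal_Form.Schur_Decomposition"
begin

definition msum :: "nat \<Rightarrow> ('a \<Rightarrow> complex mat) \<Rightarrow> 'a set \<Rightarrow> complex mat" where
  "msum N f A = mat N N (\<lambda>ij. \<Sum>x\<in>A. f x $$ ij)"

text \<open>The power series of the exponential, taken entrywise; it converges for every
  square matrix, see \<open>summable_mexp\<close>.\<close>

definition mexp :: "complex mat \<Rightarrow> complex mat" where
  "mexp A = mat (dim_row A) (dim_row A) (\<lambda>ij. \<Sum>p. (A ^\<^sub>m p) $$ ij / fact p)"

lemma norm_pow_mat_le:
  fixes A :: "complex mat"
  assumes A: "A \<in> carrier_mat N N" and i: "i < N" and j: "j < N"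
    and b: "\<And>i j. i < N \<Longrightarrow> j < N \<Longrightarrow> cmod (A $$ (i, j)) \<le> b"
  shows "cmod ((A ^\<^sub>m p) $$ (i, j)) \<le> (real N * b) ^ p"
  using i j
proof (induction p arbitrary: i j)
  case 0
  then show ?case using A by auto
next
  case (Suc p)
  have b0: "0 \<le> b" using b[OF Suc.prems] norm_ge_zero order_trans by blast
  have c: "A ^\<^sub>m p \<in> carrier_mat N N" using A by (rule pow_carrier_mat)
  have "(A ^\<^sub>m Suc p) $$ (i, j) = (\<Sum>l<N. (A ^\<^sub>m p) $$ (i, l) * A $$ (l, j))"
    using carrier_matD[OF A] carrier_matD[OF c] Suc.prems
    by (simp add: scalar_prod_def atLeast0LessThan del: pow_mat_dim pow_mat_dim_square)
  also have "cmod \<dots> \<le> (\<Sum>l<N. (real N * b) ^ p * b)"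
  proof (rule sum_norm_le)
    fix l assume "l \<in> {..<N}"
    then show "cmod ((A ^\<^sub>m p) $$ (i, l) * A $$ (l, j)) \<le> (real N * b) ^ p * b"
      unfolding norm_mult using Suc b b0 by (intro mult_mono) auto
  qed
  also have "\<dots> = (real N * b) ^ Suc p" by simp
  finally show ?case .
qed

lemma summable_mexp:
  fixes A :: "complex mat"
  assumes A: "A \<in> carrier_mat N N" and i: "i < N" and j: "j < N"
  shows "summable (\<lambda>p. (A ^\<^sub>m p) $$ (i, j) / fact p)"
proof -
  define b where "b = Max ((\<lambda>(i, j). cmod (A $$ (i, j))) ` ({..<N} \<times> {..<N}))"
  have b: "cmod (A $$ (i, j)) \<le> b" if "i < N" "j < N" for i j
    unfolding b_def by (rule Max_ge) (use that in auto)
  have "summable (\<lambda>p. inverse (fact p) * (real N * b) ^ p)" by (rule summable_exp)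
  then show ?thesis
  proof (rule summable_comparison_test'[where N = 0])
    fix p
    show "norm ((A ^\<^sub>m p) $$ (i, j) / fact p) \<le> inverse (fact p) * (real N * b) ^ p"
      using norm_pow_mat_le[OF A i j b, of p]
      by (simp add: norm_divide divide_simps)
  qed
qed

definition momenta :: "real \<Rightarrow> real \<Rightarrow> (real ^ 3) set" where
  "momenta L Kmax = {k. \<exists>n1 n2 n3 :: int.
     k = (2 * pi / L) *\<^sub>R vector [of_int n1, of_int n2, of_int n3] \<and>
     2 * pi / L * sqrt (of_int (n1\<^sup>2 + n2\<^sup>2 + n3\<^sup>2)) \<le> Kmax}"

lemma finite_momenta:
  assumes "L > 0"
  shows "finite (momenta L Kmax)"
proof -
  define B where "B = \<lceil>Kmax * L / (2 * pi)\<rceil>"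
  have bnd: "x \<in> {-B..B}"
    if "2 * pi / L * sqrt (of_int n) \<le> Kmax" "x\<^sup>2 \<le> n" for n x :: int
  proof -
    have "real_of_int \<bar>x\<bar> = sqrt (of_int (x\<^sup>2))" by simp
    also have "\<dots> \<le> sqrt (of_int n)" using that(2) by (intro real_sqrt_le_mono) linarith
    also have "\<dots> \<le> Kmax * L / (2 * pi)" using that(1) assms by (simp add: field_simps)
    finally have "\<bar>x\<bar> \<le> B" unfolding B_def by linarith
    then show ?thesis by auto
  qed
  have "momenta L Kmax \<subseteq>
    (\<lambda>(n1, n2, n3). (2 * pi / L) *\<^sub>R vector [of_int n1, of_int n2, of_int n3]) `
      ({-B..B} \<times> {-B..B} \<times> {-B..B})"
  proof
    fix k assume "k \<in> momenta L Kmax"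
    then obtain n1 n2 n3 :: int where
      k: "k = (2 * pi / L) *\<^sub>R vector [of_int n1, of_int n2, of_int n3]" and
      le: "2 * pi / L * sqrt (of_int (n1\<^sup>2 + n2\<^sup>2 + n3\<^sup>2)) \<le> Kmax"
      unfolding momenta_def by blast
    have "n1 \<in> {-B..B}" "n2 \<in> {-B..B}" "n3 \<in> {-B..B}"
      by (rule bnd[OF le]; simp)+
    then show "k \<in> (\<lambda>(n1, n2, n3). (2 * pi / L) *\<^sub>R vector [of_int n1, of_int n2, of_int n3]) `
      ({-B..B} \<times> {-B..B} \<times> {-B..B})"
      unfolding k by (intro image_eqI[where x = "(n1, n2, n3)"]) auto
  qed
  then show ?thesis by (rule finite_subset) auto
qed

datatype spin = Up | Down

text \<open>A set \<open>\<Lambda>\<close> of momenta, with \<open>M\<close> elements, is put in a fixed order by a bijection \<open>ord\<close>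
  from \<open>\<Lambda>\<close> to \<open>{..<M}\<close>.  The occupation numbers are then arranged as
  \<open>n\<^bsub>k Up\<^esub>, n\<^bsub>k Down\<^esub>, n\<^bsub>k' Up\<^esub>, n\<^bsub>k' Down\<^esub>, \<dots>\<close>, and \<open>slot ord k \<sigma>\<close> is the place of
  \<open>n\<^bsub>k \<sigma>\<^esub>\<close> in this arrangement, counted from 0.\<close>

fun slot :: "(real ^ 3 \<Rightarrow> nat) \<Rightarrow> real ^ 3 \<Rightarrow> spin \<Rightarrow> nat" where
  "slot ord k Up = 2 * ord k"
| "slot ord k Down = 2 * ord k + 1"

definition fock_dim :: "(real ^ 3) set \<Rightarrow> nat" where
  "fock_dim \<Lambda> = 2 ^ (2 * card \<Lambda>)"

text \<open>The standard unit vector \<open>unit_vec (fock_dim \<Lambda>) b\<close> is the one whose occupation number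
  in place \<open>q\<close> is the binary digit \<open>q\<close> of \<open>b\<close>.  In particular the vector with all
  occupation numbers zero has index 0.  Matrix column \<open>b\<close> is the image of unit vector \<open>b\<close>.\<close>

definition occ :: "nat \<Rightarrow> nat \<Rightarrow> nat" where
  "occ b q = of_bool (bit b q)"

definition annihilation ::
  "(real ^ 3) set \<Rightarrow> (real ^ 3 \<Rightarrow> nat) \<Rightarrow> real ^ 3 \<Rightarrow> spin \<Rightarrow> complex mat" where
  "annihilation \<Lambda> ord k \<sigma> =
    (let q = slot ord k \<sigma> in
     mat (fock_dim \<Lambda>) (fock_dim \<Lambda>) (\<lambda>(a, b).
       if occ b q = 1 \<and> a = unset_bit q b then (-1) ^ (\<Sum>r<q. occ b r) else 0))"

definition creation ::
  "(real ^ 3) set \<Rightarrow> (real ^ 3 \<Rightarrow> nat) \<Rightarrow> real ^ 3 \<Rightarrow> spin \<Rightarrow> complex mat" where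
  "creation \<Lambda> ord k \<sigma> =
    (let q = slot ord k \<sigma> in
     mat (fock_dim \<Lambda>) (fock_dim \<Lambda>) (\<lambda>(a, b).
       if occ b q = 0 \<and> a = set_bit q b then (-1) ^ (\<Sum>r<q. occ b r) else 0))"

definition vacuum :: "(real ^ 3) set \<Rightarrow> complex Matrix.vec" where
  "vacuum \<Lambda> = unit_vec (fock_dim \<Lambda>) 0"

text \<open>The standard inner product, antilinear in the first argument.\<close>

definition inner_prod :: "complex Matrix.vec \<Rightarrow> complex Matrix.vec \<Rightarrow> complex" where
  "inner_prod u v = v \<bullet>c u"

lemma creation_eq_adjoint: "creation \<Lambda> ord k \<sigma> = mat_adjoint (annihilation \<Lambda> ord k \<sigma>)"
proof (rule eq_matI)
  show "dim_row (creation \<Lambda> ord k \<sigma>) = dim_row (mat_adjoint (annihilation \<Lambda> ord k \<sigma>))"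
    and "dim_col (creation \<Lambda> ord k \<sigma>) = dim_col (mat_adjoint (annihilation \<Lambda> ord k \<sigma>))"
    by (simp_all add: creation_def annihilation_def mat_adjoint_def Let_def)
  fix a b
  assume "a < dim_row (mat_adjoint (annihilation \<Lambda> ord k \<sigma>))"
    "b < dim_col (mat_adjoint (annihilation \<Lambda> ord k \<sigma>))"
  then have ab: "a < fock_dim \<Lambda>" "b < fock_dim \<Lambda>"
    by (simp_all add: annihilation_def mat_adjoint_def Let_def)
  define q where "q = slot ord k \<sigma>"
  have iff: "\<not> bit b q \<and> a = set_bit q b \<longleftrightarrow> bit a q \<and> b = unset_bit q a"
  proof (intro iffI conjI; elim conjE)
    assume "\<not> bit b q" "a = set_bit q b"
    then show "bit a q" "b = unset_bit q a"
      by (auto simp: bit_set_bit_iff bit_unset_bit_iff intro!: bit_eqI)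
  next
    assume "bit a q" "b = unset_bit q a"
    then show "\<not> bit b q" "a = set_bit q b"
      by (auto simp: bit_set_bit_iff bit_unset_bit_iff intro!: bit_eqI)
  qed
  have "(\<Sum>r<q. occ b r) = (\<Sum>r<q. occ a r)" if "a = set_bit q b"
    using that by (intro sum.cong) (auto simp: occ_def bit_set_bit_iff)
  with ab iff show "creation \<Lambda> ord k \<sigma> $$ (a, b) = mat_adjoint (annihilation \<Lambda> ord k \<sigma>) $$ (a, b)"
    by (auto simp: creation_def annihilation_def mat_adjoint_def mat_of_rows_index Let_def occ_def
        simp flip: q_def)
qed

definition xi :: "real \<Rightarrow> real \<Rightarrow> real \<Rightarrow> real ^ 3 \<Rightarrow> real" where
  "xi hbar m \<mu> k = hbar\<^sup>2 * (norm k)\<^sup>2 / (2 * m) - \<mu>"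

definition G_B ::
  "(real ^ 3) set \<Rightarrow> (real ^ 3 \<Rightarrow> nat) \<Rightarrow> (real ^ 3 \<Rightarrow> real) \<Rightarrow> complex mat" where
  "G_B \<Lambda> ord \<theta> = \<i> \<cdot>\<^sub>m msum (fock_dim \<Lambda>)
    (\<lambda>k. of_real (\<theta> k) \<cdot>\<^sub>m
      (annihilation \<Lambda> ord (- k) Down * annihilation \<Lambda> ord k Up
       - creation \<Lambda> ord k Up * creation \<Lambda> ord (- k) Down)) \<Lambda>"

definition Psi_BCS ::
  "(real ^ 3) set \<Rightarrow> (real ^ 3 \<Rightarrow> nat) \<Rightarrow> (real ^ 3 \<Rightarrow> real) \<Rightarrow> complex Matrix.vec" where
  "Psi_BCS \<Lambda> ord \<theta> = mexp (\<i> \<cdot>\<^sub>m G_B \<Lambda> ord \<theta>) *\<^sub>v vacuum \<Lambda>"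

definition bogoliubov ::
  "(real ^ 3) set \<Rightarrow> (real ^ 3 \<Rightarrow> nat) \<Rightarrow> (real ^ 3 \<Rightarrow> real) \<Rightarrow> real ^ 3 \<Rightarrow> spin \<Rightarrow> complex mat" where
  "bogoliubov \<Lambda> ord \<theta> k \<sigma> =
    mexp (\<i> \<cdot>\<^sub>m G_B \<Lambda> ord \<theta>) * annihilation \<Lambda> ord k \<sigma> * mexp ((- \<i>) \<cdot>\<^sub>m G_B \<Lambda> ord \<theta>)"

definition pair_expectation ::
  "(real ^ 3) set \<Rightarrow> (real ^ 3 \<Rightarrow> nat) \<Rightarrow> (real ^ 3 \<Rightarrow> real) \<Rightarrow> real ^ 3 \<Rightarrow> complex" where
  "pair_expectation \<Lambda> ord \<theta> k =
    inner_prod (Psi_BCS \<Lambda> ord \<theta>)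
      ((annihilation \<Lambda> ord (- k) Down * annihilation \<Lambda> ord k Up) *\<^sub>v Psi_BCS \<Lambda> ord \<theta>)"

definition H_M ::
  "(real ^ 3) set \<Rightarrow> (real ^ 3 \<Rightarrow> nat) \<Rightarrow> (real ^ 3 \<Rightarrow> real) \<Rightarrow> (real ^ 3 \<Rightarrow> real) \<Rightarrow>
   (real ^ 3 \<Rightarrow> real) \<Rightarrow> complex mat" where
  "H_M \<Lambda> ord \<xi> \<Delta> \<theta> =
    msum (fock_dim \<Lambda>)
      (\<lambda>(k, \<sigma>). of_real (\<xi> k) \<cdot>\<^sub>m (creation \<Lambda> ord k \<sigma> * annihilation \<Lambda> ord k \<sigma>))
      (\<Lambda> \<times> {Up, Down})
    - msum (fock_dim \<Lambda>)
      (\<lambda>k. of_real (\<Delta> k) \<cdot>\<^sub>m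
        (annihilation \<Lambda> ord (- k) Down * annihilation \<Lambda> ord k Up
         + creation \<Lambda> ord k Up * creation \<Lambda> ord (- k) Down)) \<Lambda>
    + (\<Sum>k\<in>\<Lambda>. of_real (\<Delta> k) * pair_expectation \<Lambda> ord \<theta> k) \<cdot>\<^sub>m 1\<^sub>m (fock_dim \<Lambda>)"

end

theory Submission
  imports Defs
begin

text \<open>
  The operator \<open>X = \<i> G\<^sub>B = \<Sum>\<^sub>k \<theta>\<^sub>k (C'\<^bsub>k Up\<^esub> C'\<^bsub>-k Down\<^esub> - C\<^bsub>-k Down\<^esub> C\<^bsub>k Up\<^esub>)\<close>, where \<open>C'\<close> denotes
  creation, acts by commutators as an infinitesimal rotation on the span of \<open>C\<^bsub>k Up\<^esub>\<close> and
  \<open>C'\<^bsub>-k Down\<^esub>\<close>, and on the span of \<open>C\<^bsub>-k Down\<^esub>\<close> and \<open>C'\<^bsub>k Up\<^esub>\<close>.  Conjugation by \<open>e\<^sup>X\<close> therefore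
  rotates these planes by \<open>\<plusminus>\<theta>\<^sub>k\<close>, so \<open>\<gamma>\<^bsub>k Up\<^esub>\<close> and \<open>\<gamma>\<^bsub>-k Down\<^esub>\<close> are explicit linear combinations
  of ladder operators.  Expanding \<open>\<gamma>\<^sup>* \<gamma>\<close> for this pair and using \<open>E cos 2\<theta> = \<xi>\<close> and \<open>E sin 2\<theta> = \<Delta>\<close>,
  with \<open>E\<close> the square root of \<open>\<xi>\<^sup>2 + \<Delta>\<^sup>2\<close>, gives the \<open>k\<close>-th term of \<open>H\<^sub>M\<close>; as \<open>\<xi>\<close> and \<open>\<Delta>\<close> are even,
  the spin down terms may be summed over \<open>-k\<close> instead of \<open>k\<close>.
\<close>

section \<open>The matrix exponential\<close>

lemma index_times_mat:
  assumes "A \<in> carrier_mat N N" "B \<in> carrier_mat N N" "i < N" "j < N"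
  shows "(A * B) $$ (i, j) = (\<Sum>l<N. A $$ (i, l) * B $$ (l, j))"
  using assms by (simp add: scalar_prod_def atLeast0LessThan)

section \<open>Powers of commuting and intertwined matrices\<close>

lemma pow_mat_intertwine:
  fixes X Y D :: "'a :: comm_ring_1 mat"
  assumes X: "X \<in> carrier_mat N N" and Y: "Y \<in> carrier_mat N N" and D: "D \<in> carrier_mat N N"
    and eq: "X * D = D * Y"
  shows "X ^\<^sub>m p * D = D * Y ^\<^sub>m p"
proof (induction p)
  case 0
  then show ?case using X Y D by simp
next
  case (Suc p)
  note c = pow_carrier_mat[OF X, of p] pow_carrier_mat[OF Y, of p]
  have "X ^\<^sub>m Suc p * D = X ^\<^sub>m p * (D * Y)"
    using X D c by (simp add: eq assoc_mult_mat[of _ N N _ N _ N])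
  also have "\<dots> = D * Y ^\<^sub>m Suc p"
    using X Y D c by (simp add: assoc_mult_mat[of _ N N _ N _ N, symmetric] Suc del: assoc_mult_mat)
  finally show ?case .
qed

text \<open>Pascal's rule in the shape met in the inductive step of the binomial theorem;
  \<open>g r s\<close> will be an entry of the \<open>r\<close>-th power of \<open>X\<close> times
  the \<open>s\<close>-th power of \<open>Y\<close>.\<close>

lemma sum_choose_Suc:
  fixes g :: "nat \<Rightarrow> nat \<Rightarrow> 'a :: comm_ring_1"
  shows "(\<Sum>r\<le>p. of_nat (p choose r) * (g (Suc r) (p - r) + g r (Suc (p - r)))) =
    (\<Sum>r\<le>Suc p. of_nat (Suc p choose r) * g r (Suc p - r))"
proof -
  \<comment> \<open>Raising the upper limit to \<open>Suc p\<close> adds only a term with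
    \<open>p choose Suc p = 0\<close>.\<close>
  have "(\<Sum>r\<le>p. of_nat (p choose r) * g r (Suc (p - r))) =
      (\<Sum>r\<le>Suc p. of_nat (p choose r) * g r (Suc p - r))"
    by (simp add: Suc_diff_le binomial_eq_0)
  also have "\<dots> = g 0 (Suc p) + (\<Sum>r\<le>p. of_nat (p choose Suc r) * g (Suc r) (p - r))"
    unfolding sum.atMost_Suc_shift by simp
  finally have 1: "(\<Sum>r\<le>p. of_nat (p choose r) * g r (Suc (p - r))) =
      g 0 (Suc p) + (\<Sum>r\<le>p. of_nat (p choose Suc r) * g (Suc r) (p - r))" .
  have "(\<Sum>r\<le>Suc p. of_nat (Suc p choose r) * g r (Suc p - r)) =
      g 0 (Suc p) + ((\<Sum>r\<le>p. of_nat (p choose r) * g (Suc r) (p - r)) +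
        (\<Sum>r\<le>p. of_nat (p choose Suc r) * g (Suc r) (p - r)))"
    unfolding sum.atMost_Suc_shift by (simp add: distrib_right sum.distrib)
  then show ?thesis
    by (simp only: distrib_left sum.distrib 1 add_ac)
qed

text \<open>Stated entrywise because the exponential series is an entrywise one. Commutativity is
  what moves a new factor \<open>X\<close> to the left past a power of \<open>Y\<close>.\<close>

lemma binomial_mat:
  fixes X Y :: "'a :: comm_ring_1 mat"
  assumes X: "X \<in> carrier_mat N N" and Y: "Y \<in> carrier_mat N N" and comm: "X * Y = Y * X"
    and ij: "i < N" "j < N"
  shows "((X + Y) ^\<^sub>m p) $$ (i, j) =
    (\<Sum>r\<le>p. of_nat (p choose r) * (X ^\<^sub>m r * Y ^\<^sub>m (p - r)) $$ (i, j))"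
  using ij(2)
proof (induction p arbitrary: j)
  case 0
  then show ?case using X Y ij by simp
next
  case (Suc p)
  note c = pow_carrier_mat[OF X] pow_carrier_mat[OF Y] pow_carrier_mat[OF add_carrier_mat[OF Y, of X]]
  have step: "X ^\<^sub>m r * Y ^\<^sub>m s * (X + Y) = X ^\<^sub>m Suc r * Y ^\<^sub>m s + X ^\<^sub>m r * Y ^\<^sub>m Suc s" for r s
  proof -
    have "Y ^\<^sub>m s * X = X * Y ^\<^sub>m s"
      by (rule pow_mat_intertwine[OF Y Y X comm[symmetric]])
    then have "X ^\<^sub>m r * Y ^\<^sub>m s * X = X ^\<^sub>m r * X * Y ^\<^sub>m s"
      using X Y by (simp add: assoc_mult_mat[of _ N N _ N _ N])
    then show ?thesis
      using X Y by (simp add: mult_add_distrib_mat[OF mult_carrier_mat[of _ N N _ N] X Y]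
          assoc_mult_mat[of "X ^\<^sub>m r" N N "Y ^\<^sub>m s" N Y N])
  qed
  have "((X + Y) ^\<^sub>m Suc p) $$ (i, j) = (\<Sum>l<N. ((X + Y) ^\<^sub>m p) $$ (i, l) * (X + Y) $$ (l, j))"
    unfolding pow_mat.simps using X Y c Suc.prems ij by (intro index_times_mat) auto
  also have "\<dots> = (\<Sum>l<N. \<Sum>r\<le>p. of_nat (p choose r) *
      ((X ^\<^sub>m r * Y ^\<^sub>m (p - r)) $$ (i, l) * (X + Y) $$ (l, j)))"
    by (intro sum.cong refl) (simp add: Suc.IH sum_distrib_right mult.assoc)
  also have "\<dots> = (\<Sum>r\<le>p. of_nat (p choose r) *
      (\<Sum>l<N. (X ^\<^sub>m r * Y ^\<^sub>m (p - r)) $$ (i, l) * (X + Y) $$ (l, j)))"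
    by (subst sum.swap) (simp add: sum_distrib_left)
  also have "\<dots> = (\<Sum>r\<le>p. of_nat (p choose r) * (X ^\<^sub>m r * Y ^\<^sub>m (p - r) * (X + Y)) $$ (i, j))"
    using X Y c Suc.prems ij
    by (intro sum.cong refl arg_cong2[where f = "(*)"] index_times_mat[symmetric]) auto
  also have "\<dots> = (\<Sum>r\<le>p. of_nat (p choose r) *
      ((X ^\<^sub>m Suc r * Y ^\<^sub>m (p - r)) $$ (i, j) + (X ^\<^sub>m r * Y ^\<^sub>m Suc (p - r)) $$ (i, j)))"
    unfolding step using X Y c Suc.prems ij
    by (intro sum.cong refl arg_cong2[where f = "(*)"] index_add_mat)
      (auto simp del: pow_mat.simps)
  also have "\<dots> = (\<Sum>r\<le>Suc p. of_nat (Suc p choose r) * (X ^\<^sub>m r * Y ^\<^sub>m (Suc p - r)) $$ (i, j))"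
    by (rule sum_choose_Suc)
  finally show ?case .
qed

section \<open>Exponential law and conjugation by an exponential\<close>

lemma mexp_carrier [simp]: "A \<in> carrier_mat N N \<Longrightarrow> mexp A \<in> carrier_mat N N"
  by (simp add: mexp_def)

lemma index_mexp:
  "A \<in> carrier_mat N N \<Longrightarrow> i < N \<Longrightarrow> j < N \<Longrightarrow> mexp A $$ (i, j) = (\<Sum>p. (A ^\<^sub>m p) $$ (i, j) / fact p)"
  by (simp add: mexp_def)

text \<open>Absolute convergence is what the Cauchy product in \<open>mexp_add\<close> requires.
  With \<open>b\<close> the largest modulus of an entry, the real exponential series of
  \<open>real N * b\<close> dominates.\<close>

lemma summable_norm_mexp:
  fixes A :: "complex mat"
  assumes A: "A \<in> carrier_mat N N" and i: "i < N" and j: "j < N"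
  shows "summable (\<lambda>p. norm ((A ^\<^sub>m p) $$ (i, j) / fact p))"
proof -
  define b where "b = Max ((\<lambda>(i, j). cmod (A $$ (i, j))) ` ({..<N} \<times> {..<N}))"
  have b: "cmod (A $$ (i, j)) \<le> b" if "i < N" "j < N" for i j
    unfolding b_def by (rule Max_ge) (use that in auto)
  have "summable (\<lambda>p. inverse (fact p) * (real N * b) ^ p)" by (rule summable_exp)
  then show ?thesis
  proof (rule summable_comparison_test'[where N = 0])
    fix p
    show "norm (norm ((A ^\<^sub>m p) $$ (i, j) / fact p)) \<le> inverse (fact p) * (real N * b) ^ p"
      using norm_pow_mat_le[OF A i j b, of p]
      by (simp add: norm_divide divide_simps)
  qed
qed

text \<open>For each intermediate index \<open>l\<close> of the matrix product, two scalar series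
  are multiplied by the Cauchy product; the coefficients, summed over \<open>l\<close>, are then
  identified by \<open>binomial_mat\<close>.\<close>

lemma mexp_add:
  assumes X: "X \<in> carrier_mat N N" and Y: "Y \<in> carrier_mat N N" and comm: "X * Y = Y * X"
  shows "mexp (X + Y) = mexp X * mexp Y"
proof (rule eq_matI)
  show "dim_row (mexp (X + Y)) = dim_row (mexp X * mexp Y)"
    and "dim_col (mexp (X + Y)) = dim_col (mexp X * mexp Y)"
    using X Y by (auto simp: mexp_def)
  fix i j assume "i < dim_row (mexp X * mexp Y)" "j < dim_col (mexp X * mexp Y)"
  then have ij: "i < N" "j < N" using X Y by (auto simp: mexp_def)
  have XY: "X + Y \<in> carrier_mat N N" using X Y by simp
  define x where "x l p = (X ^\<^sub>m p) $$ (i, l) / fact p" for l p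
  define y where "y l p = (Y ^\<^sub>m p) $$ (l, j) / fact p" for l p
  have cauchy: "(\<lambda>p. \<Sum>r\<le>p. x l r * y l (p - r)) sums ((\<Sum>p. x l p) * (\<Sum>p. y l p))" if "l < N" for l
    unfolding x_def y_def using X Y ij that by (intro Cauchy_product_sums summable_norm_mexp)
  have "(\<lambda>p. \<Sum>l<N. \<Sum>r\<le>p. x l r * y l (p - r)) sums (\<Sum>l<N. (\<Sum>p. x l p) * (\<Sum>p. y l p))"
    using cauchy by (intro sums_sum) auto
  also have "(\<lambda>p. \<Sum>l<N. \<Sum>r\<le>p. x l r * y l (p - r)) = (\<lambda>p. ((X + Y) ^\<^sub>m p) $$ (i, j) / fact p)"
  proof
    fix p
    have "(\<Sum>l<N. \<Sum>r\<le>p. x l r * y l (p - r)) = (\<Sum>r\<le>p. \<Sum>l<N. x l r * y l (p - r))"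
      by (rule sum.swap)
    also have "\<dots> = (\<Sum>r\<le>p. of_nat (p choose r) * (X ^\<^sub>m r * Y ^\<^sub>m (p - r)) $$ (i, j) / fact p)"
    proof (intro sum.cong refl)
      fix r assume "r \<in> {..p}"
      \<comment> \<open>Division by \<open>fact p\<close> splits the binomial coefficient into the
        two factorials of the factor series.\<close>
      then have "(of_nat (p choose r) :: complex) / fact p = 1 / (fact r * fact (p - r))"
        by (simp add: binomial_fact)
      then have *: "of_nat (p choose r) * z / fact p = z / (fact r * fact (p - r))" for z :: complex
        by (metis mult.commute mult.right_neutral times_divide_eq_right)
      have "(X ^\<^sub>m r * Y ^\<^sub>m (p - r)) $$ (i, j) = (\<Sum>l<N. (X ^\<^sub>m r) $$ (i, l) * (Y ^\<^sub>m (p - r)) $$ (l, j))"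
        using X Y ij by (intro index_times_mat) auto
      then show "(\<Sum>l<N. x l r * y l (p - r)) =
          of_nat (p choose r) * (X ^\<^sub>m r * Y ^\<^sub>m (p - r)) $$ (i, j) / fact p"
        unfolding * by (simp add: x_def y_def sum_divide_distrib)
    qed
    also have "\<dots> = ((X + Y) ^\<^sub>m p) $$ (i, j) / fact p"
      by (simp add: binomial_mat[OF X Y comm ij] sum_divide_distrib)
    finally show "(\<Sum>l<N. \<Sum>r\<le>p. x l r * y l (p - r)) = ((X + Y) ^\<^sub>m p) $$ (i, j) / fact p" .
  qed
  finally have "(\<lambda>p. ((X + Y) ^\<^sub>m p) $$ (i, j) / fact p) sums (\<Sum>l<N. (\<Sum>p. x l p) * (\<Sum>p. y l p))" .
  then have "mexp (X + Y) $$ (i, j) = (\<Sum>l<N. (\<Sum>p. x l p) * (\<Sum>p. y l p))"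
    unfolding index_mexp[OF XY ij] by (rule sums_unique[symmetric])
  also have "\<dots> = (\<Sum>l<N. mexp X $$ (i, l) * mexp Y $$ (l, j))"
    using ij by (intro sum.cong refl) (simp add: index_mexp[OF X] index_mexp[OF Y] x_def y_def)
  also have "\<dots> = (mexp X * mexp Y) $$ (i, j)"
    using X Y ij by (intro index_times_mat[symmetric]) auto
  finally show "mexp (X + Y) $$ (i, j) = (mexp X * mexp Y) $$ (i, j)" .
qed

text \<open>The relation passes to all powers by \<open>pow_mat_intertwine\<close>, and then to the
  entrywise limits, since multiplication by \<open>D\<close> forms only finite sums of
  entries.\<close>

lemma mexp_intertwine:
  assumes X: "X \<in> carrier_mat N N" and Y: "Y \<in> carrier_mat N N" and D: "D \<in> carrier_mat N N"
    and eq: "X * D = D * Y"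
  shows "mexp X * D = D * mexp Y"
proof (rule eq_matI)
  show "dim_row (mexp X * D) = dim_row (D * mexp Y)" "dim_col (mexp X * D) = dim_col (D * mexp Y)"
    using X Y D by (auto simp: mexp_def)
  fix i j assume "i < dim_row (D * mexp Y)" "j < dim_col (D * mexp Y)"
  then have ij: "i < N" "j < N" using Y D by (auto simp: mexp_def)
  have "(\<lambda>p. \<Sum>l<N. (X ^\<^sub>m p) $$ (i, l) / fact p * D $$ (l, j)) sums
      (\<Sum>l<N. mexp X $$ (i, l) * D $$ (l, j))"
    using ij by (intro sums_sum sums_mult2) (auto simp: index_mexp[OF X] intro!: summable_sums summable_mexp[OF X])
  moreover have "(\<lambda>p. \<Sum>l<N. D $$ (i, l) * ((Y ^\<^sub>m p) $$ (l, j) / fact p)) sums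
      (\<Sum>l<N. D $$ (i, l) * mexp Y $$ (l, j))"
    using ij by (intro sums_sum sums_mult) (auto simp: index_mexp[OF Y] intro!: summable_sums summable_mexp[OF Y])
  moreover have "(\<Sum>l<N. (X ^\<^sub>m p) $$ (i, l) / fact p * D $$ (l, j)) =
      (\<Sum>l<N. D $$ (i, l) * ((Y ^\<^sub>m p) $$ (l, j) / fact p))" for p
  proof -
    have "(\<Sum>l<N. (X ^\<^sub>m p) $$ (i, l) * D $$ (l, j)) = (\<Sum>l<N. D $$ (i, l) * (Y ^\<^sub>m p) $$ (l, j))"
      using pow_mat_intertwine[OF X Y D eq, of p] X Y D ij
        index_times_mat[OF pow_carrier_mat[OF X] D ij, of p] index_times_mat[OF D pow_carrier_mat[OF Y] ij, of p]
      by (simp del: index_mult_mat)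
    then have "(\<Sum>l<N. (X ^\<^sub>m p) $$ (i, l) * D $$ (l, j)) / fact p =
        (\<Sum>l<N. D $$ (i, l) * (Y ^\<^sub>m p) $$ (l, j)) / fact p" by simp
    then show ?thesis by (simp add: sum_divide_distrib)
  qed
  ultimately have "(\<Sum>l<N. mexp X $$ (i, l) * D $$ (l, j)) = (\<Sum>l<N. D $$ (i, l) * mexp Y $$ (l, j))"
    using sums_unique2 by fastforce
  then show "(mexp X * D) $$ (i, j) = (D * mexp Y) $$ (i, j)"
    using index_times_mat[OF mexp_carrier[OF X] D ij] index_times_mat[OF D mexp_carrier[OF Y] ij] by simp
qed

lemma pow_smult_one_mat:
  "(c \<cdot>\<^sub>m 1\<^sub>m N) ^\<^sub>m p = (c ^ p :: 'a :: comm_ring_1) \<cdot>\<^sub>m 1\<^sub>m N"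
proof (induction p)
  case 0
  show ?case by (rule eq_matI) auto
next
  case (Suc p)
  have "(c ^ p \<cdot>\<^sub>m 1\<^sub>m N) * (c \<cdot>\<^sub>m 1\<^sub>m N) = c ^ p \<cdot>\<^sub>m (c \<cdot>\<^sub>m 1\<^sub>m N)"
    by (subst mult_smult_assoc_mat[of _ N N _ N]) auto
  also have "\<dots> = c ^ Suc p \<cdot>\<^sub>m 1\<^sub>m N"
    by (rule eq_matI) (auto simp: mult.commute)
  finally show ?case using Suc by simp
qed

lemma mexp_smult_one: "mexp (c \<cdot>\<^sub>m 1\<^sub>m N) = exp c \<cdot>\<^sub>m 1\<^sub>m N"
proof (rule eq_matI)
  fix i j assume "i < dim_row (exp c \<cdot>\<^sub>m 1\<^sub>m N)" "j < dim_col (exp c \<cdot>\<^sub>m 1\<^sub>m N)"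
  then have ij: "i < N" "j < N" by auto
  have "mexp (c \<cdot>\<^sub>m 1\<^sub>m N) $$ (i, j) = (\<Sum>p. c ^ p / fact p * of_bool (i = j))"
    using ij by (subst index_mexp[of _ N]) (auto simp: pow_smult_one_mat intro!: suminf_cong)
  also have "\<dots> = (\<Sum>p. c ^ p / fact p) * of_bool (i = j)"
    using summable_norm_cancel[OF summable_norm_exp[of c]]
    by (intro suminf_mult2[symmetric]) (simp add: scaleR_conv_of_real divide_inverse mult.commute)
  also have "(\<Sum>p. c ^ p / fact p) = exp c"
    by (simp add: exp_def scaleR_conv_of_real divide_inverse mult.commute)
  finally show "mexp (c \<cdot>\<^sub>m 1\<^sub>m N) $$ (i, j) = (exp c \<cdot>\<^sub>m 1\<^sub>m N) $$ (i, j)"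
    using ij by simp
qed (auto simp: mexp_def)

lemma mexp_uminus:
  assumes X: "X \<in> carrier_mat N N"
  shows "mexp X * mexp (- X) = 1\<^sub>m N"
proof -
  have "mexp X * mexp (- X) = mexp (X + - X)"
    using X by (intro mexp_add[symmetric]) (auto simp: uminus_mult_left_mat uminus_mult_right_mat)
  \<comment> \<open>The zero matrix is written as a multiple of the identity so that
    \<open>mexp_smult_one\<close> evaluates its exponential.\<close>
  also have "X + - X = 0 \<cdot>\<^sub>m 1\<^sub>m N"
    using X by (intro eq_matI) auto
  also have "mexp \<dots> = 1\<^sub>m N"
    unfolding mexp_smult_one by (intro eq_matI) auto
  finally show ?thesis .
qed

text \<open>The eigenvalue relation says that \<open>X * D\<close> equals \<open>D\<close> times
  \<open>X\<close> shifted by the scalar \<open>c\<close>. Intertwining and the exponential law then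
  pull out the factor \<open>exp c\<close>, without summing nested commutators.\<close>

lemma mexp_conj_eigen:
  assumes X: "X \<in> carrier_mat N N" and D: "D \<in> carrier_mat N N"
    and ev: "X * D - D * X = c \<cdot>\<^sub>m D"
  shows "mexp X * D * mexp (- X) = exp c \<cdot>\<^sub>m D"
proof -
  have "X * D = (X * D - D * X) + D * X"
    using X D by (intro eq_matI) auto
  also have "\<dots> = D * (X + c \<cdot>\<^sub>m 1\<^sub>m N)"
    unfolding ev using X D
    by (simp add: mult_add_distrib_mat[of _ N N _ N] mult_smult_distrib[of _ N N _ N] comm_add_mat[of _ N N])
  finally have "mexp X * D = D * mexp (X + c \<cdot>\<^sub>m 1\<^sub>m N)"
    using X D by (intro mexp_intertwine) auto
  also have "mexp (X + c \<cdot>\<^sub>m 1\<^sub>m N) = mexp X * mexp (c \<cdot>\<^sub>m 1\<^sub>m N)"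
    using X by (intro mexp_add)
      (auto simp: mult_smult_distrib[of _ N N _ N] mult_smult_assoc_mat[of _ N N _ N])
  also have "\<dots> = exp c \<cdot>\<^sub>m mexp X"
    unfolding mexp_smult_one using mexp_carrier[OF X]
    by (simp add: mult_smult_distrib[OF _ one_carrier_mat])
  finally have "mexp X * D * mexp (- X) = D * (exp c \<cdot>\<^sub>m mexp X) * mexp (- X)" by simp
  also have "\<dots> = exp c \<cdot>\<^sub>m (D * (mexp X * mexp (- X)))"
    using X D by (simp add: mult_smult_distrib[of _ N N _ N] mult_smult_assoc_mat[of _ N N _ N]
        assoc_mult_mat[of _ N N _ N _ N])
  also have "\<dots> = exp c \<cdot>\<^sub>m D"
    using D by (simp add: mexp_uminus[OF X])
  finally show ?thesis .
qed

text \<open>\<open>A + \<i> B\<close> and \<open>A - \<i> B\<close> are eigenvectors of the commutator with \<open>X\<close>.\<close>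

lemma mexp_conj_rotation:
  assumes X: "X \<in> carrier_mat N N" and A: "A \<in> carrier_mat N N" and B: "B \<in> carrier_mat N N"
    and XA: "X * A - A * X = (- t) \<cdot>\<^sub>m B" and XB: "X * B - B * X = t \<cdot>\<^sub>m A"
  shows "mexp X * A * mexp (- X) = cos t \<cdot>\<^sub>m A + (- sin t) \<cdot>\<^sub>m B"
proof -
  \<comment> \<open>Here \<open>z\<close> stands for \<open>\<i>\<close> and \<open>- \<i>\<close>
    at once; only \<open>z * z = -1\<close> matters.\<close>
  have ev: "X * (A + z \<cdot>\<^sub>m B) - (A + z \<cdot>\<^sub>m B) * X = (z * t) \<cdot>\<^sub>m (A + z \<cdot>\<^sub>m B)" if z: "z * z = -1" for z
  proof -
    have "X * (A + z \<cdot>\<^sub>m B) - (A + z \<cdot>\<^sub>m B) * X = (X * A - A * X) + z \<cdot>\<^sub>m (X * B - B * X)"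
      using X A B by (simp add: mult_add_distrib_mat[of _ N N _ N] add_mult_distrib_mat[of _ N N _ _ N]
          mult_smult_distrib[of _ N N _ N] mult_smult_assoc_mat[of _ N N _ N])
        (auto intro!: eq_matI simp: algebra_simps simp del: index_mult_mat(1))
    also have "\<dots> = (z * t) \<cdot>\<^sub>m (A + z \<cdot>\<^sub>m B)"
    proof -
      have "z * t * (z * y) = - (t * y)" for y
        using z by (metis (no_types, lifting) mult.assoc mult.commute mult_minus1)
      then show ?thesis
        unfolding XA XB using A B by (auto intro!: eq_matI simp: distrib_left)
    qed
    finally show ?thesis .
  qed
  have conj: "mexp X * (A + z \<cdot>\<^sub>m B) * mexp (- X) = exp (z * t) \<cdot>\<^sub>m (A + z \<cdot>\<^sub>m B)" if "z * z = -1" for z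
    using X A B ev[OF that] by (intro mexp_conj_eigen) auto
  let ?P = "A + \<i> \<cdot>\<^sub>m B" and ?M = "A + (- \<i>) \<cdot>\<^sub>m B"
  \<comment> \<open>\<open>A\<close> is the mean of the two eigenvectors, so its conjugate is the
    mean of their images; Euler's formula then recovers cosine and sine.\<close>
  have "A = (1 / 2) \<cdot>\<^sub>m ?P + (1 / 2) \<cdot>\<^sub>m ?M"
    using A B by (intro eq_matI) (auto simp: field_simps)
  then have "mexp X * A * mexp (- X) = mexp X * ((1 / 2) \<cdot>\<^sub>m ?P + (1 / 2) \<cdot>\<^sub>m ?M) * mexp (- X)" by simp
  also have "\<dots> = (1 / 2) \<cdot>\<^sub>m (mexp X * ?P * mexp (- X)) + (1 / 2) \<cdot>\<^sub>m (mexp X * ?M * mexp (- X))"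
  proof -
    have "E * (a \<cdot>\<^sub>m P + b \<cdot>\<^sub>m M) * F = a \<cdot>\<^sub>m (E * P * F) + b \<cdot>\<^sub>m (E * M * F)"
      if "E \<in> carrier_mat N N" "P \<in> carrier_mat N N" "M \<in> carrier_mat N N" "F \<in> carrier_mat N N"
      for E P M F :: "complex mat" and a b
      using that by (simp add: mult_add_distrib_mat[of _ N N _ N] add_mult_distrib_mat[of _ N N _ _ N]
          mult_smult_distrib[of _ N N _ N] mult_smult_assoc_mat[of _ N N _ N])
    then show ?thesis using X A B by (simp del: assoc_mult_mat)
  qed
  also have "\<dots> = (1 / 2) \<cdot>\<^sub>m (exp (\<i> * t) \<cdot>\<^sub>m ?P) + (1 / 2) \<cdot>\<^sub>m (exp (- \<i> * t) \<cdot>\<^sub>m ?M)"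
    by (simp only: conj[of \<i>] conj[of "- \<i>"] i_squared minus_mult_minus)
  also have "\<dots> = cos t \<cdot>\<^sub>m A + (- sin t) \<cdot>\<^sub>m B"
  proof (rule eq_matI)
    fix i j assume "i < dim_row (cos t \<cdot>\<^sub>m A + (- sin t) \<cdot>\<^sub>m B)" "j < dim_col (cos t \<cdot>\<^sub>m A + (- sin t) \<cdot>\<^sub>m B)"
    moreover have "1 / 2 * ((cos t + \<i> * sin t) * (a + \<i> * b)) + 1 / 2 * ((cos t - \<i> * sin t) * (a + - \<i> * b)) =
        cos t * a + - sin t * b" for a b
      by (simp add: algebra_simps)
    ultimately show "((1 / 2) \<cdot>\<^sub>m (exp (\<i> * t) \<cdot>\<^sub>m ?P) + (1 / 2) \<cdot>\<^sub>m (exp (- \<i> * t) \<cdot>\<^sub>m ?M)) $$ (i, j) =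
        (cos t \<cdot>\<^sub>m A + (- sin t) \<cdot>\<^sub>m B) $$ (i, j)"
      using A B by (simp add: exp_Euler exp_minus_Euler)
  qed (use A B in auto)
  finally show ?thesis .
qed

section \<open>Fermionic ladder operators\<close>

text \<open>The Jordan-Wigner sign. It ignores place \<open>q\<close> itself, so annihilation and
  creation in \<open>q\<close> carry the same sign.\<close>

definition jw_sign :: "nat \<Rightarrow> nat \<Rightarrow> complex" where
  "jw_sign q b = (-1) ^ (\<Sum>r<q. occ b r)"

lemma jw_sign_square [simp]: "jw_sign q b * jw_sign q b = 1"
  by (simp add: jw_sign_def flip: power_add mult_2)

text \<open>A flip before \<open>q\<close> changes the parity of the count, and any other place is
  not counted. This asymmetry between \<open>q\<close> and \<open>r\<close> is the source of
  anticommutation.\<close>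

lemma jw_sign_flip_bit: "jw_sign q (flip_bit r b) = (if r < q then - jw_sign q b else jw_sign q b)"
proof -
  \<comment> \<open>One factor for each place, so that the flipped place can be split off.\<close>
  have prod: "jw_sign q c = (\<Prod>i<q. (-1) ^ occ c i)" for c
    by (simp add: jw_sign_def power_sum)
  have other: "occ (flip_bit r b) i = occ b i" if "i \<noteq> r" for i
    using that by (simp add: occ_def bit_flip_bit_iff)
  have flipped: "(-1 :: complex) ^ occ (flip_bit r b) r = - ((-1) ^ occ b r)"
    by (simp add: occ_def bit_flip_bit_iff)
  show ?thesis
  proof (cases "r < q")
    case True
    have "jw_sign q c = (-1) ^ occ c r * (\<Prod>i\<in>{..<q} - {r}. (-1) ^ occ c i)" for c
      unfolding prod using True by (subst prod.remove[of _ r]) auto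
    moreover have "(\<Prod>i\<in>{..<q} - {r}. (-1 :: complex) ^ occ (flip_bit r b) i) =
        (\<Prod>i\<in>{..<q} - {r}. (-1) ^ occ b i)"
      by (intro prod.cong) (auto simp: other)
    ultimately show ?thesis using True by (simp add: flipped)
  next
    case False
    then show ?thesis unfolding prod by (auto simp: other intro!: prod.cong)
  qed
qed

text \<open>Annihilation (\<open>e = True\<close>) and creation (\<open>e = False\<close>) in place \<open>q\<close>, among \<open>K\<close> places.
  Treating both at once turns all the anticommutation relations into one.\<close>

definition ladder :: "nat \<Rightarrow> bool \<Rightarrow> nat \<Rightarrow> complex mat" where
  "ladder K e q = mat (2 ^ K) (2 ^ K) (\<lambda>(a, b). if bit b q = e \<and> a = flip_bit q b then jw_sign q b else 0)"

lemma ladder_carrier [simp]: "ladder K e q \<in> carrier_mat (2 ^ K) (2 ^ K)"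
  by (simp add: ladder_def)

lemma ladder_dim [simp]: "dim_row (ladder K e q) = 2 ^ K" "dim_col (ladder K e q) = 2 ^ K"
  by (simp_all add: ladder_def)

lemma annihilation_eq_ladder: "annihilation \<Lambda> ord k \<sigma> = ladder (2 * card \<Lambda>) True (slot ord k \<sigma>)"
  by (auto simp: annihilation_def ladder_def fock_dim_def Let_def occ_def jw_sign_def flip_bit_eq_if
      intro!: eq_matI)

lemma creation_eq_ladder: "creation \<Lambda> ord k \<sigma> = ladder (2 * card \<Lambda>) False (slot ord k \<sigma>)"
  by (auto simp: creation_def ladder_def fock_dim_def Let_def occ_def jw_sign_def flip_bit_eq_if
      intro!: eq_matI)

lemma flip_bit_less_power:
  fixes b :: nat
  assumes "b < 2 ^ K" "q < K"
  shows "flip_bit q b < 2 ^ K"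
proof -
  have "take_bit K (flip_bit q b) = flip_bit q b"
    using assms by (simp add: take_bit_flip_bit_eq take_bit_nat_eq_self)
  then show ?thesis by (metis take_bit_nat_less_exp)
qed

lemma flip_bit_flip_bit [simp]: "flip_bit q (flip_bit q b) = (b :: nat)"
  by (rule bit_eqI) (auto simp: bit_flip_bit_iff)

lemma flip_bit_commute: "flip_bit q (flip_bit r b) = flip_bit r (flip_bit q (b :: nat))"
  by (rule bit_eqI) (auto simp: bit_flip_bit_iff)

text \<open>A column of \<open>ladder\<close> has at most one nonzero entry, so the sum over the
  intermediate index reduces to \<open>flip_bit r j\<close>; \<open>r < K\<close> keeps this index
  in range.\<close>

lemma index_ladder_mult:
  assumes "r < K" and ij: "i < 2 ^ K" "j < 2 ^ K"
  shows "(ladder K e q * ladder K e' r) $$ (i, j) =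
    (if bit j r = e' \<and> bit (flip_bit r j) q = e \<and> i = flip_bit q (flip_bit r j)
     then jw_sign q (flip_bit r j) * jw_sign r j else 0)"
proof -
  have fl: "flip_bit r j < 2 ^ K" using assms by (intro flip_bit_less_power)
  have "(ladder K e q * ladder K e' r) $$ (i, j) =
      (\<Sum>l<2 ^ K. ladder K e q $$ (i, l) * ladder K e' r $$ (l, j))"
    using ij by (intro index_times_mat) auto
  also have "\<dots> = (\<Sum>l<2 ^ K. if l = flip_bit r j
      then ladder K e q $$ (i, flip_bit r j) * ladder K e' r $$ (flip_bit r j, j) else 0)"
    using ij by (intro sum.cong refl) (auto simp: ladder_def)
  also have "\<dots> = ladder K e q $$ (i, flip_bit r j) * ladder K e' r $$ (flip_bit r j, j)"
    using fl by simp
  finally show ?thesis using ij fl by (auto simp: ladder_def)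
qed

text \<open>The canonical anticommutation relations. For different places both orders reach the same
  unit vector with opposite signs, as only the later place sees the other flip. For one place and
  \<open>e \<noteq> e'\<close>, exactly one of the two products is nonzero on each unit vector and
  fixes it; for \<open>e = e'\<close> both vanish.\<close>

lemma ladder_anticommutator:
  assumes "q < K" "r < K"
  shows "ladder K e q * ladder K e' r + ladder K e' r * ladder K e q =
    of_bool (q = r \<and> e \<noteq> e') \<cdot>\<^sub>m 1\<^sub>m (2 ^ K)"
proof (rule eq_matI)
  fix i j assume "i < dim_row (of_bool (q = r \<and> e \<noteq> e') \<cdot>\<^sub>m 1\<^sub>m (2 ^ K) :: complex mat)"
    "j < dim_col (of_bool (q = r \<and> e \<noteq> e') \<cdot>\<^sub>m 1\<^sub>m (2 ^ K) :: complex mat)"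
  then have ij: "i < 2 ^ K" "j < 2 ^ K" by auto
  show "(ladder K e q * ladder K e' r + ladder K e' r * ladder K e q) $$ (i, j) =
      (of_bool (q = r \<and> e \<noteq> e') \<cdot>\<^sub>m 1\<^sub>m (2 ^ K)) $$ (i, j)"
  proof (cases "q = r")
    case True
    then show ?thesis using ij assms
      by (auto simp: index_ladder_mult jw_sign_flip_bit bit_flip_bit_iff simp del: index_mult_mat(1))
  next
    case False
    then show ?thesis using ij assms
      by (auto simp: index_ladder_mult jw_sign_flip_bit bit_flip_bit_iff flip_bit_commute[of q r]
          simp del: index_mult_mat(1))
  qed
qed auto

text \<open>Add and subtract \<open>A * C * B\<close>. As anticommutators of ladder operators are
  scalars, the commutator of a product of two of them with a third is linear in ladder
  operators.\<close>

lemma commutator_eq_anticommutators: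
  fixes A B C :: "'a :: comm_ring_1 mat"
  assumes "A \<in> carrier_mat N N" "B \<in> carrier_mat N N" "C \<in> carrier_mat N N"
  shows "A * B * C - C * (A * B) = A * (B * C + C * B) - (A * C + C * A) * B"
  using assms
  by (simp add: mult_add_distrib_mat[of _ N N _ N] add_mult_distrib_mat[of _ N N _ _ N]
      assoc_mult_mat[of _ N N _ N _ N]) (auto intro!: eq_matI simp del: index_mult_mat(1))

lemma ladder_pair_commutator:
  assumes "q < K" "r < K" "s < K"
  shows "ladder K e q * ladder K e' r * ladder K f s - ladder K f s * (ladder K e q * ladder K e' r) =
    of_bool (r = s \<and> e' \<noteq> f) \<cdot>\<^sub>m ladder K e q - of_bool (q = s \<and> e \<noteq> f) \<cdot>\<^sub>m ladder K e' r"
  unfolding commutator_eq_anticommutators[OF ladder_carrier ladder_carrier ladder_carrier]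
    ladder_anticommutator[OF assms(2,3)] ladder_anticommutator[OF assms(1,3)]
  by (simp add: mult_smult_distrib[OF ladder_carrier one_carrier_mat]
      mult_smult_assoc_mat[OF one_carrier_mat ladder_carrier])

section \<open>Linear combinations, adjoints and finite sums of matrices\<close>

lemma index_lincomb_mult:
  fixes A B C D :: "'a :: comm_ring_1 mat"
  assumes "A \<in> carrier_mat N N" "B \<in> carrier_mat N N" "C \<in> carrier_mat N N" "D \<in> carrier_mat N N"
    and "i < N" "j < N"
  shows "((x \<cdot>\<^sub>m A + y \<cdot>\<^sub>m B) * (z \<cdot>\<^sub>m C + w \<cdot>\<^sub>m D)) $$ (i, j) =
    x * z * (A * C) $$ (i, j) + x * w * (A * D) $$ (i, j) +
    y * z * (B * C) $$ (i, j) + y * w * (B * D) $$ (i, j)"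
  using assms
  by (simp add: index_times_mat[of _ N] sum.distrib sum_distrib_left algebra_simps del: index_mult_mat(1))

lemma mat_adjoint_carrier [simp]: "A \<in> carrier_mat N M \<Longrightarrow> mat_adjoint A \<in> carrier_mat M N"
  by (simp add: mat_adjoint_def mat_of_rows_def)

lemma index_mat_adjoint:
  fixes A :: "complex mat"
  assumes "A \<in> carrier_mat N M" "i < M" "j < N"
  shows "mat_adjoint A $$ (i, j) = cnj (A $$ (j, i))"
  using assms by (simp add: mat_adjoint_def mat_of_rows_index)

lemma mat_adjoint_lincomb:
  fixes A B :: "complex mat"
  assumes "A \<in> carrier_mat N M" "B \<in> carrier_mat N M"
  shows "mat_adjoint (x \<cdot>\<^sub>m A + y \<cdot>\<^sub>m B) = cnj x \<cdot>\<^sub>m mat_adjoint A + cnj y \<cdot>\<^sub>m mat_adjoint B"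
proof (rule eq_matI)
  show "dim_row (mat_adjoint (x \<cdot>\<^sub>m A + y \<cdot>\<^sub>m B)) = dim_row (cnj x \<cdot>\<^sub>m mat_adjoint A + cnj y \<cdot>\<^sub>m mat_adjoint B)"
    "dim_col (mat_adjoint (x \<cdot>\<^sub>m A + y \<cdot>\<^sub>m B)) = dim_col (cnj x \<cdot>\<^sub>m mat_adjoint A + cnj y \<cdot>\<^sub>m mat_adjoint B)"
    using assms by (simp_all add: mat_adjoint_def mat_of_rows_def)
  fix i j assume "i < dim_row (cnj x \<cdot>\<^sub>m mat_adjoint A + cnj y \<cdot>\<^sub>m mat_adjoint B)"
    "j < dim_col (cnj x \<cdot>\<^sub>m mat_adjoint A + cnj y \<cdot>\<^sub>m mat_adjoint B)"
  then have ij: "i < M" "j < N" using assms by (auto simp: mat_adjoint_def mat_of_rows_def)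
  have "x \<cdot>\<^sub>m A + y \<cdot>\<^sub>m B \<in> carrier_mat N M" using assms by simp
  then show "mat_adjoint (x \<cdot>\<^sub>m A + y \<cdot>\<^sub>m B) $$ (i, j) =
      (cnj x \<cdot>\<^sub>m mat_adjoint A + cnj y \<cdot>\<^sub>m mat_adjoint B) $$ (i, j)"
    using ij assms carrier_matD[OF mat_adjoint_carrier[OF assms(1)]] carrier_matD[OF mat_adjoint_carrier[OF assms(2)]]
    by (simp add: index_mat_adjoint[of _ N M])
qed

lemma mat_adjoint_mat_adjoint [simp]:
  fixes A :: "complex mat"
  shows "mat_adjoint (mat_adjoint A) = A"
proof (rule eq_matI)
  have A: "A \<in> carrier_mat (dim_row A) (dim_col A)" by simp
  show "dim_row (mat_adjoint (mat_adjoint A)) = dim_row A" "dim_col (mat_adjoint (mat_adjoint A)) = dim_col A"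
    by (simp_all add: mat_adjoint_def mat_of_rows_def)
  show "mat_adjoint (mat_adjoint A) $$ (i, j) = A $$ (i, j)" if "i < dim_row A" "j < dim_col A" for i j
    using that by (simp add: index_mat_adjoint[OF mat_adjoint_carrier[OF A]] index_mat_adjoint[OF A])
qed

section \<open>Entrywise sums of matrices\<close>

lemma msum_carrier [simp]: "msum N f A \<in> carrier_mat N N"
  by (simp add: msum_def)

lemma index_msum: "i < N \<Longrightarrow> j < N \<Longrightarrow> msum N f A $$ (i, j) = (\<Sum>x\<in>A. f x $$ (i, j))"
  by (simp add: msum_def)

lemma msum_commutator:
  assumes f: "\<And>x. x \<in> A \<Longrightarrow> f x \<in> carrier_mat N N" and D: "D \<in> carrier_mat N N"
  shows "msum N f A * D - D * msum N f A = msum N (\<lambda>x. f x * D - D * f x) A"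
proof (rule eq_matI)
  fix i j assume "i < dim_row (msum N (\<lambda>x. f x * D - D * f x) A)"
    "j < dim_col (msum N (\<lambda>x. f x * D - D * f x) A)"
  then have ij: "i < N" "j < N" by (auto simp: msum_def)
  have "(msum N f A * D) $$ (i, j) = (\<Sum>x\<in>A. (f x * D) $$ (i, j))"
  proof -
    have "(msum N f A * D) $$ (i, j) = (\<Sum>l<N. \<Sum>x\<in>A. f x $$ (i, l) * D $$ (l, j))"
      using ij D by (simp add: index_times_mat[of _ N] index_msum sum_distrib_right del: index_mult_mat(1))
    also have "\<dots> = (\<Sum>x\<in>A. (f x * D) $$ (i, j))"
      using ij D f by (subst sum.swap) (simp add: index_times_mat[of _ N] del: index_mult_mat(1))
    finally show ?thesis .
  qed
  moreover have "(D * msum N f A) $$ (i, j) = (\<Sum>x\<in>A. (D * f x) $$ (i, j))"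
  proof -
    have "(D * msum N f A) $$ (i, j) = (\<Sum>l<N. \<Sum>x\<in>A. D $$ (i, l) * f x $$ (l, j))"
      using ij D by (simp add: index_times_mat[of _ N] index_msum sum_distrib_left del: index_mult_mat(1))
    also have "\<dots> = (\<Sum>x\<in>A. (D * f x) $$ (i, j))"
      using ij D f by (subst sum.swap) (simp add: index_times_mat[of _ N] del: index_mult_mat(1))
    finally show ?thesis .
  qed
  moreover have "(f x * D - D * f x) $$ (i, j) = (f x * D) $$ (i, j) - (D * f x) $$ (i, j)"
    if "x \<in> A" for x using ij D f[OF that] by (intro index_minus_mat) auto
  ultimately show "(msum N f A * D - D * msum N f A) $$ (i, j) = msum N (\<lambda>x. f x * D - D * f x) A $$ (i, j)"
    using ij D by (simp add: index_msum sum_subtractf carrier_matD[OF msum_carrier] del: index_mult_mat(1))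
qed (use D in \<open>auto simp: msum_def\<close>)

text \<open>Extracts the single momentum that survives in a commutator of \<open>X\<close> with a
  ladder operator.\<close>

lemma msum_if_eq:
  assumes "finite A" "a \<in> A" "B \<in> carrier_mat N N" "\<And>x. x \<in> A \<Longrightarrow> f x = of_bool (x = a) \<cdot>\<^sub>m B"
  shows "msum N f A = B"
proof (rule eq_matI)
  fix i j assume "i < dim_row B" "j < dim_col B"
  then have ij: "i < N" "j < N" using assms by auto
  have "msum N f A $$ (i, j) = (\<Sum>x\<in>A. if x = a then B $$ (i, j) else 0)"
    unfolding index_msum[OF ij] using assms(3,4) ij by (intro sum.cong) auto
  then show "msum N f A $$ (i, j) = B $$ (i, j)" using assms(1,2) by simp
qed (use assms in \<open>auto simp: msum_def\<close>)

section \<open>The Bogoliubov transform\<close>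

text \<open>Closure under negation gives the partner \<open>- k\<close> of each momentum a genuine
  place in the order. The angles are arbitrary here and become tied to the gap only in the final
  theorem.\<close>

locale bcs_momenta =
  fixes \<Lambda> :: "(real ^ 3) set" and ord :: "real ^ 3 \<Rightarrow> nat" and \<theta> :: "real ^ 3 \<Rightarrow> real"
  assumes ord: "bij_betw ord \<Lambda> {..<card \<Lambda>}"
    and uminus_mem: "k \<in> \<Lambda> \<Longrightarrow> - k \<in> \<Lambda>"
begin

abbreviation "N \<equiv> fock_dim \<Lambda>"
abbreviation "C \<equiv> annihilation \<Lambda> ord"
abbreviation "C' \<equiv> creation \<Lambda> ord"

text \<open>The two terms have signs opposite to those in \<open>G_B\<close>, because the factor
  \<open>\<i>\<close> of \<open>G_B\<close> and the one in the exponent multiply to -1.\<close>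

definition "pair_gen k = C' k Up * C' (- k) Down - C (- k) Down * C k Up"

definition "X = msum N (\<lambda>k. of_real (\<theta> k) \<cdot>\<^sub>m pair_gen k) \<Lambda>"

lemma finite_momentum_set: "finite \<Lambda>"
  using bij_betw_finite[OF ord] by simp

lemma slot_less: "k \<in> \<Lambda> \<Longrightarrow> slot ord k \<sigma> < 2 * card \<Lambda>"
  using bij_betwE[OF ord] by (cases \<sigma>) force+

text \<open>Up places are even and Down places odd, so parity separates the spins; injectivity of
  \<open>ord\<close> separates the momenta.\<close>

lemma slot_eq_iff:
  "k \<in> \<Lambda> \<Longrightarrow> k' \<in> \<Lambda> \<Longrightarrow> slot ord k \<sigma> = slot ord k' \<sigma>' \<longleftrightarrow> k = k' \<and> \<sigma> = \<sigma>'"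
  using bij_betw_imp_inj_on[OF ord] by (cases \<sigma>; cases \<sigma>') (auto dest: inj_onD, presburger+)

lemma C_carrier [simp]: "C k \<sigma> \<in> carrier_mat N N" "C' k \<sigma> \<in> carrier_mat N N"
  by (simp_all add: annihilation_eq_ladder creation_eq_ladder fock_dim_def)

lemma pair_gen_carrier [simp]: "pair_gen k \<in> carrier_mat N N"
  by (simp add: pair_gen_def minus_carrier_mat mult_carrier_mat[of _ N N _ N])

lemma X_carrier [simp]: "X \<in> carrier_mat N N"
  by (simp add: X_def)

lemma i_G_B: "\<i> \<cdot>\<^sub>m G_B \<Lambda> ord \<theta> = X" "(- \<i>) \<cdot>\<^sub>m G_B \<Lambda> ord \<theta> = - X"
proof -
  have eq: "\<i> \<cdot>\<^sub>m G_B \<Lambda> ord \<theta> = X"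
  proof (rule eq_matI)
    fix i j assume "i < dim_row X" "j < dim_col X"
    then have ij: "i < N" "j < N" by (auto simp: X_def msum_def)
    have "(of_real (\<theta> k) \<cdot>\<^sub>m (C (- k) Down * C k Up - C' k Up * C' (- k) Down)) $$ (i, j) =
        - (of_real (\<theta> k) \<cdot>\<^sub>m pair_gen k) $$ (i, j)" for k
    proof -
      note carrier_matD[OF C_carrier(1)] carrier_matD[OF C_carrier(2)]
      then show ?thesis using ij by (simp add: pair_gen_def algebra_simps del: index_mult_mat(1))
    qed
    then show "(\<i> \<cdot>\<^sub>m G_B \<Lambda> ord \<theta>) $$ (i, j) = X $$ (i, j)"
      using ij by (simp add: G_B_def X_def index_msum sum_negf carrier_matD[OF msum_carrier])
  qed (auto simp: G_B_def X_def msum_def)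
  then show "\<i> \<cdot>\<^sub>m G_B \<Lambda> ord \<theta> = X" .
  show "(- \<i>) \<cdot>\<^sub>m G_B \<Lambda> ord \<theta> = - X"
    unfolding eq[symmetric] by (rule eq_matI) auto
qed

text \<open>Only the generator of \<open>k\<close> fails to commute with \<open>D\<close>, so a
  single angle remains; \<open>z\<close> will be 1 or -1 and fixes the sense of rotation.\<close>

lemma X_commutator:
  assumes k: "k \<in> \<Lambda>" and D: "D \<in> carrier_mat N N" and B: "B \<in> carrier_mat N N"
    and eq: "\<And>l. l \<in> \<Lambda> \<Longrightarrow> pair_gen l * D - D * pair_gen l = (of_bool (l = k) * z) \<cdot>\<^sub>m B"
  shows "X * D - D * X = (z * of_real (\<theta> k)) \<cdot>\<^sub>m B"
proof -
  have "X * D - D * X = msum N (\<lambda>l. (of_real (\<theta> l) \<cdot>\<^sub>m pair_gen l) * D - D * (of_real (\<theta> l) \<cdot>\<^sub>m pair_gen l)) \<Lambda>"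
    unfolding X_def using D by (intro msum_commutator) auto
  also have "\<dots> = (z * of_real (\<theta> k)) \<cdot>\<^sub>m B"
  proof (rule msum_if_eq[OF finite_momentum_set k])
    fix l assume l: "l \<in> \<Lambda>"
    have "(of_real (\<theta> l) \<cdot>\<^sub>m pair_gen l) * D - D * (of_real (\<theta> l) \<cdot>\<^sub>m pair_gen l) =
        of_real (\<theta> l) \<cdot>\<^sub>m (pair_gen l * D - D * pair_gen l)"
      unfolding mult_smult_assoc_mat[OF pair_gen_carrier D] mult_smult_distrib[OF D pair_gen_carrier]
      using D carrier_matD[OF pair_gen_carrier]
      by (intro eq_matI) (auto simp: algebra_simps simp del: index_mult_mat(1))
    also have "\<dots> = of_bool (l = k) \<cdot>\<^sub>m ((z * of_real (\<theta> k)) \<cdot>\<^sub>m B)"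
      unfolding eq[OF l] by (intro eq_matI) auto
    finally show "(of_real (\<theta> l) \<cdot>\<^sub>m pair_gen l) * D - D * (of_real (\<theta> l) \<cdot>\<^sub>m pair_gen l) =
        of_bool (l = k) \<cdot>\<^sub>m ((z * of_real (\<theta> k)) \<cdot>\<^sub>m B)" .
  qed (use B in simp)
  finally show ?thesis .
qed

text \<open>Keeps all four contractions of a pair generator with one ladder operator, before it is
  decided which places coincide.\<close>

lemma pair_gen_commutator:
  assumes l: "l \<in> \<Lambda>" and D: "D = ladder (2 * card \<Lambda>) f s" and s: "s < 2 * card \<Lambda>"
  shows "pair_gen l * D - D * pair_gen l =
    (of_bool (slot ord (- l) Down = s \<and> False \<noteq> f) \<cdot>\<^sub>m C' l Up - of_bool (slot ord l Up = s \<and> False \<noteq> f) \<cdot>\<^sub>m C' (- l) Down)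
    - (of_bool (slot ord l Up = s \<and> True \<noteq> f) \<cdot>\<^sub>m C (- l) Down - of_bool (slot ord (- l) Down = s \<and> True \<noteq> f) \<cdot>\<^sub>m C l Up)"
proof -
  let ?L = "ladder (2 * card \<Lambda>)"
  have "(P - Q) * D - D * (P - Q) = (P * D - D * P) - (Q * D - D * Q)"
    if "P \<in> carrier_mat N N" "Q \<in> carrier_mat N N" for P Q
  proof -
    have "D \<in> carrier_mat N N" by (simp add: D fock_dim_def)
    then show ?thesis using that
      by (simp add: minus_mult_distrib_mat[of _ N N _ _ N] mult_minus_distrib_mat[of _ N N _ N])
        (auto intro!: eq_matI simp del: index_mult_mat(1))
  qed
  note split = this[OF mult_carrier_mat[OF C_carrier(2,2)] mult_carrier_mat[OF C_carrier(1,1)]]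
  show ?thesis
    unfolding pair_gen_def split unfolding D annihilation_eq_ladder creation_eq_ladder
      ladder_pair_commutator[OF slot_less[OF l] slot_less[OF uminus_mem[OF l]] s]
      ladder_pair_commutator[OF slot_less[OF uminus_mem[OF l]] slot_less[OF l] s]
    by (rule refl)
qed

text \<open>The generator of \<open>l\<close> involves only the places of \<open>l\<close> Up and
  \<open>- l\<close> Down. Distinct momenta give disjoint pairs, so only \<open>l = k\<close>
  contributes.\<close>

lemma pair_gen_commutators:
  assumes l: "l \<in> \<Lambda>" and k: "k \<in> \<Lambda>"
  shows "pair_gen l * C k Up - C k Up * pair_gen l = (of_bool (l = k) * (-1)) \<cdot>\<^sub>m C' (- k) Down"
    and "pair_gen l * C' (- k) Down - C' (- k) Down * pair_gen l = (of_bool (l = k) * 1) \<cdot>\<^sub>m C k Up"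
    and "pair_gen l * C (- k) Down - C (- k) Down * pair_gen l = (of_bool (l = k) * 1) \<cdot>\<^sub>m C' k Up"
    and "pair_gen l * C' k Up - C' k Up * pair_gen l = (of_bool (l = k) * (-1)) \<cdot>\<^sub>m C (- k) Down"
proof -
  note mem = l k uminus_mem[OF l] uminus_mem[OF k]
  note rules = slot_eq_iff mem carrier_matD[OF C_carrier(1)] carrier_matD[OF C_carrier(2)]
  show "pair_gen l * C k Up - C k Up * pair_gen l = (of_bool (l = k) * (-1)) \<cdot>\<^sub>m C' (- k) Down"
    unfolding pair_gen_commutator[OF l annihilation_eq_ladder slot_less[OF mem(2)]]
    by (intro eq_matI) (auto simp: rules simp del: slot.simps)
  show "pair_gen l * C' (- k) Down - C' (- k) Down * pair_gen l = (of_bool (l = k) * 1) \<cdot>\<^sub>m C k Up"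
    unfolding pair_gen_commutator[OF l creation_eq_ladder slot_less[OF mem(4)]]
    by (intro eq_matI) (auto simp: rules simp del: slot.simps)
  show "pair_gen l * C (- k) Down - C (- k) Down * pair_gen l = (of_bool (l = k) * 1) \<cdot>\<^sub>m C' k Up"
    unfolding pair_gen_commutator[OF l annihilation_eq_ladder slot_less[OF mem(4)]]
    by (intro eq_matI) (auto simp: rules simp del: slot.simps)
  show "pair_gen l * C' k Up - C' k Up * pair_gen l = (of_bool (l = k) * (-1)) \<cdot>\<^sub>m C (- k) Down"
    unfolding pair_gen_commutator[OF l creation_eq_ladder slot_less[OF mem(2)]]
    by (intro eq_matI) (auto simp: rules simp del: slot.simps)
qed

lemma bogoliubov_Up:
  assumes k: "k \<in> \<Lambda>"
  shows "bogoliubov \<Lambda> ord \<theta> k Up =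
    of_real (cos (\<theta> k)) \<cdot>\<^sub>m C k Up + of_real (- sin (\<theta> k)) \<cdot>\<^sub>m C' (- k) Down"
proof -
  have "mexp X * C k Up * mexp (- X) =
      cos (of_real (\<theta> k)) \<cdot>\<^sub>m C k Up + (- sin (of_real (\<theta> k))) \<cdot>\<^sub>m C' (- k) Down"
    using X_commutator[OF k C_carrier(1,2) pair_gen_commutators(1)[OF _ k]]
      X_commutator[OF k C_carrier(2,1) pair_gen_commutators(2)[OF _ k]]
    by (intro mexp_conj_rotation[OF X_carrier]) auto
  then show ?thesis by (simp add: bogoliubov_def i_G_B cos_of_real sin_of_real)
qed

text \<open>Indexed by \<open>- k\<close>, the partner of \<open>k\<close> Up, so that the same
  angle \<open>\<theta> k\<close> governs both transforms.\<close>

lemma bogoliubov_Down: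
  assumes k: "k \<in> \<Lambda>"
  shows "bogoliubov \<Lambda> ord \<theta> (- k) Down =
    of_real (cos (\<theta> k)) \<cdot>\<^sub>m C (- k) Down + of_real (sin (\<theta> k)) \<cdot>\<^sub>m C' k Up"
proof -
  \<comment> \<open>The brackets have signs opposite to the Up case, so the rotation is applied with
    angle \<open>- \<theta> k\<close>.\<close>
  have "mexp X * C (- k) Down * mexp (- X) =
      cos (- of_real (\<theta> k)) \<cdot>\<^sub>m C (- k) Down + (- sin (- of_real (\<theta> k))) \<cdot>\<^sub>m C' k Up"
    using X_commutator[OF k C_carrier(1,2) pair_gen_commutators(3)[OF _ k]]
      X_commutator[OF k C_carrier(2,1) pair_gen_commutators(4)[OF _ k]]
    by (intro mexp_conj_rotation[OF X_carrier]) auto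
  then show ?thesis by (simp add: bogoliubov_def i_G_B cos_of_real sin_of_real)
qed

section \<open>Number operators of a transformed pair\<close>

lemma mat_adjoint_creation: "mat_adjoint (C' k \<sigma>) = C k \<sigma>"
  by (simp add: creation_eq_adjoint)

text \<open>Read from left to right, these reorder the products arising from the transformed number
  operators into those that occur in \<open>H_M\<close>.\<close>

lemma index_anticommutator:
  assumes "k \<in> \<Lambda>" "k' \<in> \<Lambda>" and ij: "i < N" "j < N"
  shows "(C k \<sigma> * C k' \<sigma>') $$ (i, j) = - (C k' \<sigma>' * C k \<sigma>) $$ (i, j)"
    and "(C' k \<sigma> * C' k' \<sigma>') $$ (i, j) = - (C' k' \<sigma>' * C' k \<sigma>) $$ (i, j)"
    and "(C k \<sigma> * C' k \<sigma>) $$ (i, j) = of_bool (i = j) - (C' k \<sigma> * C k \<sigma>) $$ (i, j)"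
proof -
  have sum: "P $$ (i, j) + Q $$ (i, j) = R $$ (i, j)" if "P + Q = R" "dim_row Q = N" "dim_col Q = N"
    for P Q R :: "complex mat"
    using that ij by (metis index_add_mat(1))
  note car = ladder_anticommutator[OF slot_less slot_less]
  show "(C k \<sigma> * C k' \<sigma>') $$ (i, j) = - (C k' \<sigma>' * C k \<sigma>) $$ (i, j)"
    using sum[OF car[OF assms(1,2), of True \<sigma> True \<sigma>']] ij
    by (simp add: annihilation_eq_ladder fock_dim_def eq_neg_iff_add_eq_0 del: index_mult_mat(1))
  show "(C' k \<sigma> * C' k' \<sigma>') $$ (i, j) = - (C' k' \<sigma>' * C' k \<sigma>) $$ (i, j)"
    using sum[OF car[OF assms(1,2), of False \<sigma> False \<sigma>']] ij
    by (simp add: creation_eq_ladder fock_dim_def eq_neg_iff_add_eq_0 del: index_mult_mat(1))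
  show "(C k \<sigma> * C' k \<sigma>) $$ (i, j) = of_bool (i = j) - (C' k \<sigma> * C k \<sigma>) $$ (i, j)"
    using sum[OF car[OF assms(1,1), of True \<sigma> False \<sigma>]] ij
    by (auto simp: annihilation_eq_ladder creation_eq_ladder fock_dim_def eq_diff_eq simp del: index_mult_mat(1))
qed

text \<open>Each transformed number operator alone mixes the two occupations asymmetrically. In the
  sum both get the coefficient \<open>c * c - s * s\<close>, the pair terms get
  \<open>- 2 * s * c\<close>, and reordering leaves the constant \<open>2 * s * s\<close>; these are
  double-angle expressions.\<close>

lemma bogoliubov_number_sum:
  assumes k: "k \<in> \<Lambda>" and ij: "i < N" "j < N"
  defines "\<gamma> \<equiv> bogoliubov \<Lambda> ord \<theta>"
  shows "(mat_adjoint (\<gamma> k Up) * \<gamma> k Up) $$ (i, j) +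
      (mat_adjoint (\<gamma> (- k) Down) * \<gamma> (- k) Down) $$ (i, j) =
    of_real (cos (2 * \<theta> k)) * ((C' k Up * C k Up) $$ (i, j) + (C' (- k) Down * C (- k) Down) $$ (i, j))
    - of_real (sin (2 * \<theta> k)) * ((C (- k) Down * C k Up) $$ (i, j) + (C' k Up * C' (- k) Down) $$ (i, j))
    + of_real (1 - cos (2 * \<theta> k)) * of_bool (i = j)"
proof -
  define c s :: complex where "c = of_real (cos (\<theta> k))" and "s = of_real (sin (\<theta> k))"
  note mk = uminus_mem[OF k]
  have up: "\<gamma> k Up = c \<cdot>\<^sub>m C k Up + (- s) \<cdot>\<^sub>m C' (- k) Down"
    and down: "\<gamma> (- k) Down = c \<cdot>\<^sub>m C (- k) Down + s \<cdot>\<^sub>m C' k Up"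
    by (simp_all add: \<gamma>_def bogoliubov_Up bogoliubov_Down k c_def s_def)
  have real: "cnj c = c" "cnj s = s" by (simp_all add: c_def s_def)
  have adj: "mat_adjoint (\<gamma> k Up) = c \<cdot>\<^sub>m C' k Up + (- s) \<cdot>\<^sub>m C (- k) Down"
    "mat_adjoint (\<gamma> (- k) Down) = c \<cdot>\<^sub>m C' (- k) Down + s \<cdot>\<^sub>m C k Up"
    unfolding up down
    by (simp_all add: mat_adjoint_lincomb[of _ N N] real mat_adjoint_creation creation_eq_adjoint[symmetric])
  define nu nd p p' where "nu = (C' k Up * C k Up) $$ (i, j)" and "nd = (C' (- k) Down * C (- k) Down) $$ (i, j)"
    and "p = (C (- k) Down * C k Up) $$ (i, j)" and "p' = (C' k Up * C' (- k) Down) $$ (i, j)"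
  have car: "(C (- k) Down * C' (- k) Down) $$ (i, j) = of_bool (i = j) - nd"
    "(C k Up * C' k Up) $$ (i, j) = of_bool (i = j) - nu"
    "(C k Up * C (- k) Down) $$ (i, j) = - p" "(C' (- k) Down * C' k Up) $$ (i, j) = - p'"
    unfolding nu_def nd_def p_def p'_def 
    by (rule index_anticommutator(3)[OF mk mk ij] index_anticommutator(3)[OF k k ij]
        index_anticommutator(1)[OF k mk ij] index_anticommutator(2)[OF mk k ij])+
  have "(mat_adjoint (\<gamma> k Up) * \<gamma> k Up) $$ (i, j) =
      c * c * nu - c * s * p' - s * c * p + s * s * (of_bool (i = j) - nd)"
    unfolding adj unfolding up
    using index_lincomb_mult[OF C_carrier(2,1,1,2) ij] by (simp add: car nu_def p_def p'_def del: index_mult_mat(1))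
  moreover have "(mat_adjoint (\<gamma> (- k) Down) * \<gamma> (- k) Down) $$ (i, j) =
      c * c * nd - c * s * p' - s * c * p + s * s * (of_bool (i = j) - nu)"
    unfolding adj unfolding down
    using index_lincomb_mult[OF C_carrier(2,1,1,2) ij] by (simp add: car nd_def p_def p'_def del: index_mult_mat(1))
  moreover have "of_real (cos (2 * \<theta> k)) = c * c - s * s" "of_real (sin (2 * \<theta> k)) = 2 * (s * c)"
    by (simp_all add: c_def s_def cos_double sin_double power2_eq_square)
  moreover have "of_real (1 - cos (2 * \<theta> k)) = 2 * (s * s)"
    by (simp add: s_def cos_double_sin power2_eq_square)
  ultimately show ?thesis
    unfolding nu_def[symmetric] nd_def[symmetric] p_def[symmetric] p'_def[symmetric]
    by (simp only:) (simp add: algebra_simps)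
qed

end

section \<open>Summation over all momenta\<close>

lemma uminus_mem_momenta:
  assumes "k \<in> momenta L Kmax"
  shows "- k \<in> momenta L Kmax"
proof -
  obtain n1 n2 n3 :: int where k: "k = (2 * pi / L) *\<^sub>R vector [of_int n1, of_int n2, of_int n3]"
    and le: "2 * pi / L * sqrt (of_int (n1\<^sup>2 + n2\<^sup>2 + n3\<^sup>2)) \<le> Kmax"
    using assms unfolding momenta_def by blast
  have "- k = (2 * pi / L) *\<^sub>R vector [of_int (- n1), of_int (- n2), of_int (- n3)]"
    unfolding k by (simp add: Finite_Cartesian_Product.vec_eq_iff forall_3)
  moreover have "2 * pi / L * sqrt (of_int ((- n1)\<^sup>2 + (- n2)\<^sup>2 + (- n3)\<^sup>2)) \<le> Kmax"
    using le by simp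
  ultimately show ?thesis unfolding momenta_def by blast
qed

lemma sum_over_spins:
  "(\<Sum>x\<in>A \<times> {Up, Down}. f x) = (\<Sum>k\<in>A. f (k, Up)) + (\<Sum>k\<in>A. f (k, Down))"
  by (simp add: sum.cartesian_product' sum.distrib)

theorem proposition3p7:
  fixes L Kmax m \<mu> hbar :: real
    and \<Lambda> :: "(real ^ 3) set"
    and ord :: "real ^ 3 \<Rightarrow> nat"
    and \<xi> \<Delta> \<theta> :: "real ^ 3 \<Rightarrow> real"
    and U :: "real ^ 3 \<Rightarrow> real ^ 3 \<Rightarrow> real"
  assumes "L > 0" and "Kmax > 0" and "m > 0" and "\<mu> > 0" and "hbar > 0"
    and Lambda: "\<Lambda> = momenta L Kmax"
    and ord: "bij_betw ord \<Lambda> {..<card \<Lambda>}"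
    and xi: "\<xi> = xi hbar m \<mu>"
    and U_nonpos: "\<And>k k'. k \<in> \<Lambda> \<Longrightarrow> k' \<in> \<Lambda> \<Longrightarrow> U k k' \<le> 0"
    and U_sym: "\<And>k k'. k \<in> \<Lambda> \<Longrightarrow> k' \<in> \<Lambda> \<Longrightarrow> U k' k = U k k'"
    and U_even: "\<And>k k'. k \<in> \<Lambda> \<Longrightarrow> k' \<in> \<Lambda> \<Longrightarrow> U (- k) (- k') = U k k'"
    and U_diag: "\<And>k. k \<in> \<Lambda> \<Longrightarrow> U k k = 0"
    and Delta_nonneg: "\<And>k. k \<in> \<Lambda> \<Longrightarrow> \<Delta> k \<ge> 0"
    and Delta_even: "\<And>k. k \<in> \<Lambda> \<Longrightarrow> \<Delta> (- k) = \<Delta> k"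
    and gap_pos: "\<And>k. k \<in> \<Lambda> \<Longrightarrow> (\<xi> k)\<^sup>2 + (\<Delta> k)\<^sup>2 > 0"
    and gap_eq: "\<And>k. k \<in> \<Lambda> \<Longrightarrow>
      \<Delta> k = - (1 / 2) * (\<Sum>k'\<in>\<Lambda>. U k k' * \<Delta> k' / sqrt ((\<xi> k')\<^sup>2 + (\<Delta> k')\<^sup>2))"
    and theta_range: "\<And>k. k \<in> \<Lambda> \<Longrightarrow> \<theta> k \<in> {0..pi / 2}"
    and theta_sin: "\<And>k. k \<in> \<Lambda> \<Longrightarrow> sin (2 * \<theta> k) = \<Delta> k / sqrt ((\<xi> k)\<^sup>2 + (\<Delta> k)\<^sup>2)"
    and theta_cos: "\<And>k. k \<in> \<Lambda> \<Longrightarrow> cos (2 * \<theta> k) = \<xi> k / sqrt ((\<xi> k)\<^sup>2 + (\<Delta> k)\<^sup>2)"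
  shows "H_M \<Lambda> ord \<xi> \<Delta> \<theta> =
    msum (fock_dim \<Lambda>)
      (\<lambda>(k, \<sigma>). of_real (sqrt ((\<xi> k)\<^sup>2 + (\<Delta> k)\<^sup>2)) \<cdot>\<^sub>m
        (mat_adjoint (bogoliubov \<Lambda> ord \<theta> k \<sigma>) * bogoliubov \<Lambda> ord \<theta> k \<sigma>))
      (\<Lambda> \<times> {Up, Down})
    + (\<Sum>k\<in>\<Lambda>. of_real (\<xi> k - sqrt ((\<xi> k)\<^sup>2 + (\<Delta> k)\<^sup>2))
        + of_real (\<Delta> k) * pair_expectation \<Lambda> ord \<theta> k) \<cdot>\<^sub>m 1\<^sub>m (fock_dim \<Lambda>)"
proof (rule eq_matI)
  interpret bcs_momenta \<Lambda> ord \<theta>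
    using ord uminus_mem_momenta unfolding Lambda by unfold_locales auto
  let ?E = "\<lambda>k. sqrt ((\<xi> k)\<^sup>2 + (\<Delta> k)\<^sup>2)"
  let ?\<gamma> = "bogoliubov \<Lambda> ord \<theta>"
  let ?R = "msum (fock_dim \<Lambda>)
      (\<lambda>(k, \<sigma>). of_real (?E k) \<cdot>\<^sub>m (mat_adjoint (?\<gamma> k \<sigma>) * ?\<gamma> k \<sigma>)) (\<Lambda> \<times> {Up, Down})
    + (\<Sum>k\<in>\<Lambda>. of_real (\<xi> k - ?E k) + of_real (\<Delta> k) * pair_expectation \<Lambda> ord \<theta> k) \<cdot>\<^sub>m 1\<^sub>m (fock_dim \<Lambda>)"
  show "dim_row (H_M \<Lambda> ord \<xi> \<Delta> \<theta>) = dim_row ?R" "dim_col (H_M \<Lambda> ord \<xi> \<Delta> \<theta>) = dim_col ?R"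
    by (simp_all add: H_M_def)
  fix i j assume "i < dim_row ?R" "j < dim_col ?R"
  then have ij: "i < N" "j < N" by auto
  define d :: complex where "d = of_bool (i = j)"
  \<comment> \<open>The pair expectations occur identically on both sides and are carried along
    unevaluated.\<close>
  define S where "S = (\<Sum>k\<in>\<Lambda>. of_real (\<Delta> k) * pair_expectation \<Lambda> ord \<theta> k)"
  define n where "n k \<sigma> = (C' k \<sigma> * C k \<sigma>) $$ (i, j)" for k \<sigma>
  define g where "g k \<sigma> = (mat_adjoint (?\<gamma> k \<sigma>) * ?\<gamma> k \<sigma>) $$ (i, j)" for k \<sigma>
  define p where "p k = (C (- k) Down * C k Up) $$ (i, j) + (C' k Up * C' (- k) Down) $$ (i, j)" for k
  have reindex: "(\<Sum>k\<in>\<Lambda>. f k) = (\<Sum>k\<in>\<Lambda>. f (- k))" for f :: "real ^ 3 \<Rightarrow> complex"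
    by (rule sum.reindex_bij_witness[of _ uminus uminus]) (auto simp: uminus_mem)
  \<comment> \<open>\<open>\<xi>\<close> is even because the momentum enters only through its
    norm.\<close>
  have even: "\<xi> (- k) = \<xi> k" "\<Delta> (- k) = \<Delta> k" if "k \<in> \<Lambda>" for k
    using Delta_even[OF that] by (simp_all add: xi xi_def)
  have "?\<gamma> k \<sigma> \<in> carrier_mat N N" for k \<sigma>
    unfolding bogoliubov_def i_G_B by (simp add: mult_carrier_mat[of _ N N _ N])
  then have dims: "dim_row (?\<gamma> k \<sigma>) = N" "dim_col (?\<gamma> k \<sigma>) = N"
    "dim_row (mat_adjoint (?\<gamma> k \<sigma>)) = N" for k \<sigma>
    using mat_adjoint_carrier by blast+
  note Cdims = carrier_matD[OF C_carrier(1)] carrier_matD[OF C_carrier(2)]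
  have "H_M \<Lambda> ord \<xi> \<Delta> \<theta> $$ (i, j) =
      (\<Sum>k\<in>\<Lambda>. of_real (\<xi> k) * n k Up) + (\<Sum>k\<in>\<Lambda>. of_real (\<xi> k) * n k Down)
      - (\<Sum>k\<in>\<Lambda>. of_real (\<Delta> k) * p k) + S * d"
    unfolding H_M_def S_def[symmetric] using ij
    by (simp add: index_msum sum_over_spins n_def p_def d_def Cdims carrier_matD[OF msum_carrier]
        del: index_mult_mat(1))
  \<comment> \<open>Only the Down sum is reindexed: this joins \<open>k\<close> Up with
    \<open>- k\<close> Down under a common coefficient, as \<open>bogoliubov_number_sum\<close>
    requires.\<close>
  also have "\<dots> = (\<Sum>k\<in>\<Lambda>. of_real (\<xi> k) * (n k Up + n (- k) Down) - of_real (\<Delta> k) * p k) + S * d"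
    unfolding reindex[of "\<lambda>k. of_real (\<xi> k) * n k Down"]
    by (simp add: even sum.distrib sum_subtractf distrib_left)
  also have "(\<Sum>k\<in>\<Lambda>. of_real (\<xi> k) * (n k Up + n (- k) Down) - of_real (\<Delta> k) * p k) =
      (\<Sum>k\<in>\<Lambda>. of_real (?E k) * (g k Up + g (- k) Down) + of_real (\<xi> k - ?E k) * d)"
  proof (rule sum.cong[OF refl])
    fix k assume k: "k \<in> \<Lambda>"
    \<comment> \<open>Clearing this denominator turns the definition of the angle into polar
      coordinates for \<open>\<xi> k\<close> and \<open>\<Delta> k\<close> with radius
      \<open>?E k\<close>.\<close>
    have "?E k \<noteq> 0" using gap_pos[OF k] by auto
    then have "\<xi> k = ?E k * cos (2 * \<theta> k)" "\<Delta> k = ?E k * sin (2 * \<theta> k)"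
      by (simp_all add: theta_cos[OF k] theta_sin[OF k])
    then have eqs: "of_real (\<xi> k) = of_real (?E k) * complex_of_real (cos (2 * \<theta> k))"
      "of_real (\<Delta> k) = of_real (?E k) * complex_of_real (sin (2 * \<theta> k))"
      by (metis of_real_mult)+
    have g: "g k Up + g (- k) Down = of_real (cos (2 * \<theta> k)) * (n k Up + n (- k) Down)
        - of_real (sin (2 * \<theta> k)) * p k + of_real (1 - cos (2 * \<theta> k)) * d"
      unfolding g_def n_def p_def d_def by (rule bogoliubov_number_sum[OF k ij])
    show "of_real (\<xi> k) * (n k Up + n (- k) Down) - of_real (\<Delta> k) * p k =
        of_real (?E k) * (g k Up + g (- k) Down) + of_real (\<xi> k - ?E k) * d"
      unfolding g of_real_diff eqs by (simp add: algebra_simps)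
  qed
  \<comment> \<open>The reindexing is undone on the transformed side; the coefficient is even
    because \<open>\<xi>\<close> and \<open>\<Delta>\<close> are.\<close>
  also have "\<dots> = (\<Sum>k\<in>\<Lambda>. of_real (?E k) * g k Up) + (\<Sum>k\<in>\<Lambda>. of_real (?E k) * g k Down)
      + (\<Sum>k\<in>\<Lambda>. of_real (\<xi> k - ?E k)) * d"
    unfolding reindex[of "\<lambda>k. of_real (?E k) * g k Down"]
    by (simp add: even sum.distrib distrib_left sum_distrib_right del: of_real_diff)
  finally show "H_M \<Lambda> ord \<xi> \<Delta> \<theta> $$ (i, j) = ?R $$ (i, j)"
    using ij by (simp add: index_msum sum_over_spins g_def d_def S_def dims sum.distrib distrib_right
        carrier_matD[OF msum_carrier] del: index_mult_mat(1) of_real_diff)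
qed

end
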